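(* The set of $n\in\mathbb{N}$ such that the numbers $n+1,n+2,\dots,n+5$ are deficient has positive density.
   Context: $\mathbb{N}=\{1,2,\dots\}$. For $n\in\mathbb{N}$ let $s(n):=\sum_{d\mid n,\,d<n}d$ (sum of proper positive divisors). $n$ is deficient if $s(n)<n$. The density of $E\subset\mathbb{N}$ is $\lim_{N\to\infty}\frac1N|E\cap[1,N]|$ when the limit exists. *)

theory Defs
  imports Complex_Main
begin

definition proper_divisor_sum :: "nat \<Rightarrow> nat" where
  "proper_divisor_sum n = (\<Sum>d | d dvd n \<and> d < n. d)"

definition deficient :: "nat \<Rightarrow> bool" where
  "deficient n \<longleftrightarrow> proper_divisor_sum n < n"

(* Existence of the limit is part of the relation. Only the positive elements of E count. *)
definition has_density :: "nat set \<Rightarrow> real \<Rightarrow> bool" where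
  "has_density E \<delta> \<longleftrightarrow>
     (\<lambda>N. real (card (E \<inter> {1..N})) / real N) \<longlonglongrightarrow> \<delta>"

end

theory Submission
  imports Defs "HOL-Computational_Algebra.Primes" "HOL-Analysis.Harmonic_Numbers"
begin

text \<open>
  Let $h(n)=\sigma(n)/n=\sum_{d\mid n}1/d$, so that $n$ is deficient iff $h(n)<2$. For a bound $y$ split
  $h(n)$ into the sum over $d\le y$, which is periodic in $n$, and the sum over $d>y$, which is small
  for most $n$ since its mean is at most $1/y$.

  Existence of the density. The condition that the small parts of $n+1,\dots,n+5$ are below $2$ defines a
  periodic set, which has a density. It contains the set of the theorem, and it suffices to show that
  the difference has arbitrarily small upper density (\<open>convergent_density_if_approximable\<close>). A number
  whose small part is below $2$ while $h$ is at least $2$ has a large part of at least $\varepsilon$, which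
  is rare when $y$ is large, or satisfies $2\le h<2+\varepsilon$. So what is needed is that $h$ rarely falls
  just above $2$ (\<open>abundancy_not_concentrated\<close>). The reason is that most $n$ are exactly divisible by
  some prime $p$ from a suitable finite set of large primes. Dividing by $p$ maps the $n$ with
  $2\le h(n)<2+\varepsilon$ injectively to much smaller numbers, because $h(n/p)=h(n)/(1+1/p)$ reveals $p$.

  Positivity of the density (\<open>deficient_window_frequent\<close>). Let $n$ be a multiple of a number $M$ that all
  $d\le y$ divide. Then the small divisors of $n+i$ are divisors of $i$, so the small part of $h(n+i)$ is at
  most $h(i)\le 7/4$ for $1\le i\le 5$. The large parts are below $1/4$ for at least half of these $n$.
\<close>

section \<open>Abundancy\<close>

text \<open>The classical abundancy index $\sigma(n)/n$: replacing $d$ by $n/d$ turns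
  $\sigma(n)/n$ into a sum of reciprocals, which can be truncated at small $d$.\<close>

definition abundancy :: "nat \<Rightarrow> real" where
  "abundancy n = (\<Sum>d | d dvd n. 1 / real d)"

text \<open>The truncation: it depends only on $n$ modulo any common multiple of $1,\dots,y$.\<close>

definition small_part :: "nat \<Rightarrow> nat \<Rightarrow> real" where
  "small_part y n = (\<Sum>d | d \<in> {1..y} \<and> d dvd n. 1 / real d)"

text \<open>The remainder of the truncation. Its mean is at most $\sum_{d>y} d^{-2}\le 1/y$.\<close>

definition large_part :: "nat \<Rightarrow> nat \<Rightarrow> real" where
  "large_part y n = (\<Sum>d | y < d \<and> d dvd n. 1 / real d)"

lemma abundancy_split:
  assumes "n \<ge> 1"
  shows "abundancy n = small_part y n + large_part y n"
proof -
  have fin: "finite {d. d dvd n}" using assms by simp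
  have "{d. d dvd n} = {d. d \<in> {1..y} \<and> d dvd n} \<union> {d. y < d \<and> d dvd n}"
    using assms by (auto simp: Suc_le_eq intro: Nat.gr0I)
  then show ?thesis
    unfolding abundancy_def small_part_def large_part_def
    by (metis (no_types, lifting) sum.union_disjoint fin finite_Un
        disjoint_iff mem_Collect_eq atLeastAtMost_iff not_le)
qed

lemma large_part_nonneg: "large_part y n \<ge> 0"
  unfolding large_part_def by (simp add: sum_nonneg)

lemma abundancy_ge_1:
  assumes "n \<ge> 1"
  shows "abundancy n \<ge> 1"
proof -
  have "(\<Sum>d\<in>{1::nat}. 1 / real d) \<le> abundancy n"
    unfolding abundancy_def using assms by (intro sum_mono2) auto
  then show ?thesis by simp
qed

lemma deficient_iff_abundancy:
  assumes "n \<ge> 1"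
  shows "deficient n \<longleftrightarrow> abundancy n < 2"
proof -
  have "(\<Sum>d | d dvd n. real d) = (\<Sum>d | d dvd n. real n * (1 / real d))"
    by (rule sum.reindex_bij_witness[of _ "\<lambda>d. n div d" "\<lambda>d. n div d"])
       (use assms in \<open>auto simp: real_of_nat_div\<close>)
  then have sigma: "(\<Sum>d | d dvd n. real d) = real n * abundancy n"
    unfolding abundancy_def by (simp add: sum_distrib_left)
  have "{d. d dvd n} = insert n {d. d dvd n \<and> d < n}"
    using assms by (auto dest: dvd_imp_le)
  moreover have "finite {d. d dvd n \<and> d < n}" by simp
  ultimately have "(\<Sum>d | d dvd n. real d) = real n + real (proper_divisor_sum n)"
    unfolding proper_divisor_sum_def by simp
  with sigma have "real (proper_divisor_sum n) = real n * (abundancy n - 1)"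
    by (simp add: algebra_simps)
  then have "real (proper_divisor_sum n) < real n \<longleftrightarrow> real n * (abundancy n - 1) < real n * 1"
    by simp
  also have "\<dots> \<longleftrightarrow> abundancy n < 2"
    using assms by (subst mult_less_cancel_left_pos) auto
  finally show ?thesis unfolding deficient_def by simp
qed

text \<open>The divisors of $pm$ are those of $m$ together with their multiples by $p$.\<close>

lemma abundancy_prime_times:
  assumes "prime p" "\<not> p dvd m" "m \<ge> 1"
  shows "abundancy (p * m) = (1 + 1 / real p) * abundancy m"
proof -
  have "{d. d dvd p * m} = {d. d dvd m} \<union> (\<lambda>d. p * d) ` {d. d dvd m}"
  proof (intro equalityI subsetI)
    fix d assume "d \<in> {d. d dvd p * m}"
    then have d: "d dvd p * m" by simp
    show "d \<in> {d. d dvd m} \<union> (\<lambda>d. p * d) ` {d. d dvd m}"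
    proof (cases "p dvd d")
      case True
      then obtain e where "d = p * e" by blast
      with d assms(1) show ?thesis by (auto simp: prime_gt_0_nat)
    next
      case False
      then have "coprime d p"
        using assms(1) by (metis coprime_commute prime_imp_coprime)
      with d show ?thesis by (simp add: coprime_dvd_mult_right_iff)
    qed
  qed auto
  moreover have "{d. d dvd m} \<inter> (\<lambda>d. p * d) ` {d. d dvd m} = {}"
    using assms(2) by (auto dest: dvd_mult_left)
  moreover have "finite {d. d dvd m}" using assms(3) by simp
  ultimately have "abundancy (p * m) = abundancy m + (\<Sum>d\<in>(\<lambda>d. p * d) ` {d. d dvd m}. 1 / real d)"
    unfolding abundancy_def by (simp add: sum.union_disjoint)
  also have "(\<Sum>d\<in>(\<lambda>d. p * d) ` {d. d dvd m}. 1 / real d) = (\<Sum>d | d dvd m. 1 / real p * (1 / real d))"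
    using assms(1) by (subst sum.reindex) (auto simp: inj_on_def prime_gt_0_nat)
  also have "\<dots> = 1 / real p * abundancy m"
    unfolding abundancy_def by (simp add: sum_distrib_left)
  finally show ?thesis by (simp add: algebra_simps)
qed

section \<open>Densities of periodic sets\<close>

definition count_upto :: "nat set \<Rightarrow> nat \<Rightarrow> nat" where
  "count_upto A N = card (A \<inter> {1..N})"

lemma count_upto_periodic:
  assumes periodic: "\<And>n. n + Q \<in> F \<longleftrightarrow> n \<in> F"
  shows "count_upto F (N + Q) = count_upto F N + count_upto F Q"
proof -
  have "F \<inter> {1..N + Q} = (F \<inter> {1..Q}) \<union> (\<lambda>n. n + Q) ` (F \<inter> {1..N})"
  proof (intro equalityI subsetI)
    fix n assume n: "n \<in> F \<inter> {1..N + Q}"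
    show "n \<in> (F \<inter> {1..Q}) \<union> (\<lambda>n. n + Q) ` (F \<inter> {1..N})"
    proof (cases "n \<le> Q")
      case False
      then have "n = (n - Q) + Q" "n - Q \<in> {1..N}" using n by auto
      with n periodic[of "n - Q"] show ?thesis by (auto intro!: image_eqI[of n _ "n - Q"])
    qed (use n in auto)
  qed (use periodic in auto)
  moreover have "(F \<inter> {1..Q}) \<inter> (\<lambda>n. n + Q) ` (F \<inter> {1..N}) = {}" by auto
  ultimately show ?thesis
    unfolding count_upto_def
    by (simp add: card_Un_disjoint card_image)
qed

lemma tendsto_if_bounded_error:
  fixes f :: "nat \<Rightarrow> real"
  assumes "\<And>N. \<bar>f N - real N * c\<bar> \<le> C"
  shows "(\<lambda>N. f N / real N) \<longlonglongrightarrow> c"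
proof (rule LIM_zero_cancel, rule Lim_null_comparison)
  show "\<forall>\<^sub>F N in sequentially. norm (f N / real N - c) \<le> C / real N"
    using eventually_gt_at_top[of 0]
  proof eventually_elim
    case (elim N)
    then have "f N / real N - c = (f N - real N * c) / real N" by (simp add: field_simps)
    with assms[of N] elim show ?case by (simp add: divide_right_mono)
  qed
  show "(\<lambda>N. C / real N) \<longlonglongrightarrow> 0"
    by (rule lim_const_over_n)
qed

text \<open>The deviation of the counting function from its linear trend is itself
  $Q$-periodic, hence bounded.\<close>

lemma convergent_density_periodic:
  assumes "Q \<ge> 1" and periodic: "\<And>n. n + Q \<in> F \<longleftrightarrow> n \<in> F"
  shows "convergent (\<lambda>N. real (count_upto F N) / real N)"
proof -
  define c where "c = real (count_upto F Q) / real Q"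
  define err where "err N = real (count_upto F N) - real N * c" for N
  have err_periodic: "err (N + Q) = err N" for N
    unfolding err_def c_def using assms count_upto_periodic[of Q F N]
    by (simp add: field_simps)
  have err_mod: "err N = err (N mod Q)" for N
  proof -
    have "err (k * Q + r) = err r" for k r
      by (induction k) (simp_all add: err_periodic add.commute add.left_commute, metis add.assoc add.commute err_periodic)
    from this[of "N div Q" "N mod Q"] show ?thesis by simp
  qed
  have "\<bar>err N\<bar> \<le> Max ((\<lambda>r. \<bar>err r\<bar>) ` {..<Q})" for N
    using assms(1) by (subst err_mod) (intro Max_ge, auto)
  then show ?thesis
    using tendsto_if_bounded_error[of "\<lambda>N. real (count_upto F N)" c]
    unfolding err_def convergent_def by blast
qed

lemma small_part_periodic:
  assumes "\<And>d. d \<in> {1..y} \<Longrightarrow> d dvd Q"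
  shows "small_part y (n + Q) = small_part y n"
  unfolding small_part_def using assms
  by (intro sum.cong) (auto simp: dvd_add_left_iff)

section \<open>Sets of small upper density\<close>

text \<open>This implies that the upper density of $A$ is at most $c$; a bound that holds from
  some point on is easier to add and to transport than an upper limit.\<close>

definition eventually_density_le :: "nat set \<Rightarrow> real \<Rightarrow> bool" where
  "eventually_density_le A c \<longleftrightarrow> (\<forall>\<^sub>F N in sequentially. real (count_upto A N) \<le> c * real N)"

lemma count_upto_mono: "A \<inter> {1..N} \<subseteq> B \<Longrightarrow> count_upto A N \<le> count_upto B N"
  unfolding count_upto_def by (intro card_mono) auto

lemma count_upto_Un: "count_upto (A \<union> B) N \<le> count_upto A N + count_upto B N"
  unfolding count_upto_def by (simp add: Int_Un_distrib2 card_Un_le)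

lemma eventually_density_le_Un:
  assumes "eventually_density_le A a" "eventually_density_le B b"
  shows "eventually_density_le (A \<union> B) (a + b)"
  using assms unfolding eventually_density_le_def
proof eventually_elim
  case (elim N)
  then show ?case using count_upto_Un[of A B N] by (simp add: algebra_simps)
qed

lemma eventually_density_le_subset:
  assumes "eventually_density_le B b" "\<And>n. n \<ge> 1 \<Longrightarrow> n \<in> A \<Longrightarrow> n \<in> B" "b \<le> c"
  shows "eventually_density_le A c"
  using assms(1) unfolding eventually_density_le_def
proof eventually_elim
  case (elim N)
  have "count_upto A N \<le> count_upto B N" using assms(2) by (intro count_upto_mono) auto
  moreover have "b * real N \<le> c * real N" using assms(3) by (intro mult_right_mono) auto
  ultimately show ?case using elim by linarith
qed

text \<open>The counting ratios of $E$ are eventually within $e$ of those of $F$, which form a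
  Cauchy sequence. So the ratios of $E$ form a Cauchy sequence too, and the value of the limit need
  not be known.\<close>

lemma convergent_density_if_approximable:
  assumes approx: "\<And>e. e > 0 \<Longrightarrow> \<exists>F. E \<subseteq> F \<and>
      convergent (\<lambda>N. real (count_upto F N) / real N) \<and> eventually_density_le (F - E) e"
  shows "convergent (\<lambda>N. real (count_upto E N) / real N)"
proof (rule Cauchy_convergent, rule metric_CauchyI)
  fix e :: real assume "e > 0"
  then obtain F where F: "E \<subseteq> F" "convergent (\<lambda>N. real (count_upto F N) / real N)"
      "eventually_density_le (F - E) (e / 4)"
    using approx[of "e / 4"] by auto
  have "\<forall>\<^sub>F N in sequentially. \<bar>real (count_upto F N) / real N - real (count_upto E N) / real N\<bar> \<le> e / 4"
    using F(3) eventually_gt_at_top[of 0] unfolding eventually_density_le_def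
  proof eventually_elim
    case (elim N)
    have "F = E \<union> (F - E)" using F(1) by auto
    then have "count_upto F N \<le> count_upto E N + count_upto (F - E) N"
      by (metis count_upto_Un)
    moreover have "count_upto E N \<le> count_upto F N" using F(1) by (intro count_upto_mono) auto
    ultimately have "\<bar>real (count_upto F N) - real (count_upto E N)\<bar> \<le> e / 4 * real N"
      using elim by linarith
    then show ?case using elim
      by (simp add: diff_divide_distrib[symmetric] pos_divide_le_eq)
  qed
  then obtain N1 where N1: "\<And>N. N \<ge> N1 \<Longrightarrow>
      \<bar>real (count_upto F N) / real N - real (count_upto E N) / real N\<bar> \<le> e / 4"
    unfolding eventually_sequentially by auto
  have "Cauchy (\<lambda>N. real (count_upto F N) / real N)"
    using F(2) by (rule convergent_Cauchy)
  from metric_CauchyD[OF this, of "e / 4"] \<open>e > 0\<close> obtain N2 where N2: "\<And>m n. m \<ge> N2 \<Longrightarrow> n \<ge> N2 \<Longrightarrow>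
      \<bar>real (count_upto F m) / real m - real (count_upto F n) / real n\<bar> < e / 4"
    unfolding dist_real_def by auto
  show "\<exists>M. \<forall>m\<ge>M. \<forall>n\<ge>M. dist (real (count_upto E m) / real m) (real (count_upto E n) / real n) < e"
  proof (intro exI allI impI)
    fix m n assume "m \<ge> max N1 N2" "n \<ge> max N1 N2"
    then show "dist (real (count_upto E m) / real m) (real (count_upto E n) / real n) < e"
      using N1[of m] N1[of n] N2[of m n] \<open>e > 0\<close> unfolding dist_real_def max.bounded_iff
      by linarith
  qed
qed

section \<open>Integers without prime factors in a given set\<close>

text \<open>One half of the Euler product, for integers composed of primes in $P$. Adding one
  prime $p$ to $P$ changes the sum $T$ to some $T'$. A new $n$ is a multiple $pm$ of another such integer, so
  $T' \le T + T'/p$; this avoids expanding a product of geometric series.\<close>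

lemma sum_reciprocals_supported_le:
  fixes P :: "nat set"
  assumes "finite P" "\<And>p. p \<in> P \<Longrightarrow> prime p"
  shows "(\<Sum>n | n \<in> {1..N} \<and> (\<forall>q. prime q \<and> q dvd n \<longrightarrow> q \<in> P). 1 / real n)
           \<le> (\<Prod>p\<in>P. 1 / (1 - 1 / real p))"
  using assms
proof (induction P rule: finite_induct)
  case empty
  have "n = 1" if "n \<in> {1..N}" "\<forall>q. \<not> (prime q \<and> q dvd n)" for n
    using that prime_factor_nat[of n] by auto
  then have "(\<Sum>n | n \<in> {1..N} \<and> (\<forall>q. prime q \<and> q dvd n \<longrightarrow> q \<in> {}). 1 / real n)
      \<le> (\<Sum>n\<in>{1::nat}. 1 / real n)"
    by (intro sum_mono2) auto
  then show ?case by simp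
next
  case (insert p P)
  define S where "S P = {n. n \<in> {1..N} \<and> (\<forall>q. prime q \<and> q dvd n \<longrightarrow> q \<in> P)}" for P
  define T where "T P = (\<Sum>n\<in>S P. 1 / real n)" for P
  have p: "prime p" using insert.prems by simp
  then have p1: "1 < p" by (rule prime_gt_1_nat)
  have fin: "finite (S P)" for P unfolding S_def by simp
  have "S (insert p P) \<subseteq> S P \<union> (\<lambda>m. p * m) ` S (insert p P)"
  proof
    fix n assume n: "n \<in> S (insert p P)"
    show "n \<in> S P \<union> (\<lambda>m. p * m) ` S (insert p P)"
    proof (cases "p dvd n")
      case True
      then obtain m where m: "n = p * m" by blast
      with n p1 have "m \<in> {1..N}"
        unfolding S_def by (auto simp: Suc_le_eq intro: Nat.gr0I order.trans[of m "p * m"])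
      with n m have "m \<in> S (insert p P)"
        unfolding S_def by (auto intro: dvd_mult)
      with m show ?thesis by blast
    next
      case False
      with n show ?thesis unfolding S_def by auto
    qed
  qed
  then have "T (insert p P) \<le> (\<Sum>n\<in>S P \<union> (\<lambda>m. p * m) ` S (insert p P). 1 / real n)"
    unfolding T_def using fin by (intro sum_mono2) auto
  also have "\<dots> \<le> T P + (\<Sum>n\<in>(\<lambda>m. p * m) ` S (insert p P). 1 / real n)"
    unfolding T_def using fin by (subst sum.union_inter[symmetric]) (auto intro!: sum_nonneg)
  also have "(\<Sum>n\<in>(\<lambda>m. p * m) ` S (insert p P). 1 / real n) = (\<Sum>m\<in>S (insert p P). 1 / real p * (1 / real m))"
    using p1 by (subst sum.reindex) (auto simp: inj_on_def)
  also have "\<dots> = 1 / real p * T (insert p P)"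
    unfolding T_def by (simp add: sum_distrib_left)
  finally have "(1 - 1 / real p) * T (insert p P) \<le> T P" by (simp add: algebra_simps)
  then have "T (insert p P) \<le> 1 / (1 - 1 / real p) * T P"
    using p1 by (simp add: pos_le_divide_eq mult.commute)
  also have "\<dots> \<le> 1 / (1 - 1 / real p) * (\<Prod>p\<in>P. 1 / (1 - 1 / real p))"
    using insert.IH insert.prems p1 unfolding T_def S_def by (intro mult_left_mono) auto
  finally show ?case
    using insert.hyps unfolding T_def S_def by simp
qed

text \<open>By the Euler product, $\prod_{p\le X}(1-1/p)$ is at most the reciprocal of the
  $X$-th harmonic number, so it tends to $0$. Dropping the finitely many factors with $p\le K$
  does not change that.\<close>

lemma prime_products_small:
  fixes e :: real
  assumes "e > 0"
  obtains P :: "nat set" where "finite P" "\<And>p. p \<in> P \<Longrightarrow> prime p" "\<And>p. p \<in> P \<Longrightarrow> K < p"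
    "(\<Prod>p\<in>P. 1 - 1 / real p) < e"
proof -
  define R where "R X = (\<Prod>p | prime p \<and> p \<in> {1..X}. 1 - 1 / real p)" for X
  have R_pos: "R X > 0" for X
    unfolding R_def by (intro prod_pos) (auto dest: prime_gt_1_nat)
  have R_le: "R X * harm X \<le> 1" for X
  proof -
    have "{n. n \<in> {1..X} \<and> (\<forall>q. prime q \<and> q dvd n \<longrightarrow> q \<in> {p. prime p \<and> p \<in> {1..X}})} = {1..X}"
      by (auto dest: dvd_imp_le prime_gt_0_nat)
    then have "harm X = (\<Sum>n | n \<in> {1..X} \<and>
        (\<forall>q. prime q \<and> q dvd n \<longrightarrow> q \<in> {p. prime p \<and> p \<in> {1..X}}). 1 / real n)"
      unfolding harm_def inverse_eq_divide by (simp only: of_nat_id)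
    also have "\<dots> \<le> (\<Prod>p | prime p \<and> p \<in> {1..X}. 1 / (1 - 1 / real p))"
      by (rule sum_reciprocals_supported_le) auto
    also have "\<dots> = 1 / R X"
      unfolding R_def by (simp add: prod_dividef)
    finally show ?thesis using R_pos[of X] by (simp add: field_simps)
  qed
  have "\<forall>\<^sub>F X in sequentially. harm X > 1 / (e * R K)"
    using harm_at_top[unfolded filterlim_at_top_dense] by blast
  then have "\<forall>\<^sub>F X in sequentially. harm X > 1 / (e * R K) \<and> X \<ge> K"
    using eventually_ge_at_top[of K] by eventually_elim auto
  then obtain X where X: "harm X > 1 / (e * R K)" "X \<ge> K"
    using eventually_happens'[OF sequentially_bot] by fast
  define P where "P = {p. prime p \<and> p \<in> {K<..X}}"
  have "{p. prime p \<and> p \<in> {1..X}} = {p. prime p \<and> p \<in> {1..K}} \<union> P"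
    unfolding P_def using X(2) by (auto dest: prime_gt_0_nat)
  moreover have "{p. prime p \<and> p \<in> {1..K}} \<inter> P = {}" unfolding P_def by auto
  ultimately have split: "R X = R K * (\<Prod>p\<in>P. 1 - 1 / real p)"
    unfolding R_def P_def by (simp add: prod.union_disjoint)
  have "1 < e * R K * harm X"
    using X(1) \<open>e > 0\<close> R_pos[of K] by (simp add: field_simps)
  then have "R X * 1 < R X * (e * R K * harm X)"
    using R_pos[of X] by (intro mult_strict_left_mono)
  also have "\<dots> = e * R K * (R X * harm X)" by simp
  also have "\<dots> \<le> e * R K * 1"
    using R_le[of X] \<open>e > 0\<close> R_pos[of K] by (intro mult_left_mono) auto
  finally have "R K * (\<Prod>p\<in>P. 1 - 1 / real p) < R K * e"
    by (simp add: split mult.commute)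
  then have "(\<Prod>p\<in>P. 1 - 1 / real p) < e"
    using R_pos[of K] by simp
  then show ?thesis
    by (intro that[of P]) (auto simp: P_def)
qed

text \<open>Sieving out one more prime $p$ removes the multiples $pm$ with $m$ already free of the
  other primes. So the counting functions satisfy $D'(N) = D(N) - D(\lfloor N/p\rfloor)$, and by
  induction the error stays bounded.\<close>

lemma count_upto_free_of_primes:
  fixes P :: "nat set"
  assumes "finite P" "\<And>p. p \<in> P \<Longrightarrow> prime p"
  shows "\<exists>C. \<forall>N. \<bar>real (count_upto {n. \<forall>p\<in>P. \<not> p dvd n} N) - real N * (\<Prod>p\<in>P. 1 - 1 / real p)\<bar> \<le> C"
  using assms
proof (induction P rule: finite_induct)
  case empty
  show ?case by (intro exI[of _ 0]) (simp add: count_upto_def)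
next
  case (insert p P)
  define D where "D P = {n::nat. \<forall>p\<in>P. \<not> p dvd n}" for P
  define \<pi> where "\<pi> = (\<Prod>p\<in>P. 1 - 1 / real p)"
  from insert obtain C where C: "\<And>N. \<bar>real (count_upto (D P) N) - real N * \<pi>\<bar> \<le> C"
    unfolding D_def \<pi>_def by auto
  have p: "prime p" using insert.prems by simp
  then have p1: "1 < p" by (rule prime_gt_1_nat)
  have pi01: "0 \<le> \<pi>" "\<pi> \<le> 1"
  proof -
    have "1 / real q \<le> 1" if "q \<in> P" for q
      using insert.prems[of q] that prime_gt_0_nat[of q] by simp
    then show "0 \<le> \<pi>" "\<pi> \<le> 1" unfolding \<pi>_def
      by (auto intro!: prod_nonneg prod_le_1)
  qed
  have split: "count_upto (D P) N = count_upto (D (insert p P)) N + count_upto (D P) (N div p)" for N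
  proof -
    have dvd_iff: "q dvd p * m \<longleftrightarrow> q dvd m" if "q \<in> P" for q m
      using that insert.hyps insert.prems p primes_dvd_imp_eq prime_dvd_mult_iff
      by (metis insert_iff dvd_mult)
    have "D P \<inter> {1..N} = (D (insert p P) \<inter> {1..N}) \<union> (\<lambda>m. p * m) ` (D P \<inter> {1..N div p})"
    proof (intro equalityI subsetI)
      fix n assume n: "n \<in> D P \<inter> {1..N}"
      show "n \<in> (D (insert p P) \<inter> {1..N}) \<union> (\<lambda>m. p * m) ` (D P \<inter> {1..N div p})"
      proof (cases "p dvd n")
        case True
        then obtain m where m: "n = p * m" by blast
        with n have "m \<in> D P" unfolding D_def by (auto simp: dvd_iff)
        moreover have "m \<in> {1..N div p}"
          using n m p1 by (auto simp: less_eq_div_iff_mult_less_eq mult.commute Suc_le_eq intro: Nat.gr0I)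
        ultimately show ?thesis using m by blast
      qed (use n in \<open>auto simp: D_def\<close>)
    next
      fix n assume "n \<in> (D (insert p P) \<inter> {1..N}) \<union> (\<lambda>m. p * m) ` (D P \<inter> {1..N div p})"
      then show "n \<in> D P \<inter> {1..N}"
        using p1 by (auto simp: D_def dvd_iff dvd_iff[unfolded mult.commute[of p]] less_eq_div_iff_mult_less_eq mult.commute Suc_le_eq)
    qed
    moreover have "(D (insert p P) \<inter> {1..N}) \<inter> (\<lambda>m. p * m) ` (D P \<inter> {1..N div p}) = {}"
      by (auto simp: D_def)
    moreover have "inj_on (\<lambda>m. p * m) A" for A using p1 by (auto simp: inj_on_def)
    ultimately show ?thesis
      unfolding count_upto_def by (simp add: card_Un_disjoint card_image)
  qed
  have "\<bar>real (count_upto (D (insert p P)) N) - real N * ((1 - 1 / real p) * \<pi>)\<bar> \<le> 2 * C + 1" for N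
  proof -
    define q r where "q = real (N div p)" and "r = real N / real p"
    have "0 \<le> r - q" "r - q \<le> 1"
      using p1 floor_divide_of_nat_eq[of N p, where ?'a = real] unfolding q_def r_def
      by linarith+
    then have "0 \<le> (r - q) * \<pi>" "(r - q) * \<pi> \<le> 1"
      using pi01 by (auto intro: mult_le_one)
    moreover have "real N * ((1 - 1 / real p) * \<pi>) = real N * \<pi> - q * \<pi> - (r - q) * \<pi>"
      unfolding r_def by (simp add: algebra_simps)
    moreover have "\<bar>real (count_upto (D (insert p P)) N) + real (count_upto (D P) (N div p)) - real N * \<pi>\<bar> \<le> C"
      using C[of N] unfolding split[of N] of_nat_add .
    moreover have "\<bar>real (count_upto (D P) (N div p)) - q * \<pi>\<bar> \<le> C"
      using C[of "N div p"] unfolding q_def .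
    ultimately show ?thesis
      unfolding abs_le_iff by argo
  qed
  then show ?case
    using insert.hyps unfolding D_def \<pi>_def
    by (intro exI[of _ "2 * C + 1"]) simp
qed

lemma eventually_density_le_free_of_primes:
  fixes P :: "nat set"
  assumes "finite P" "\<And>p. p \<in> P \<Longrightarrow> prime p" "(\<Prod>p\<in>P. 1 - 1 / real p) < c"
  shows "eventually_density_le {n. \<forall>p\<in>P. \<not> p dvd n} c"
proof -
  obtain C where "\<And>N. \<bar>real (count_upto {n. \<forall>p\<in>P. \<not> p dvd n} N) - real N * (\<Prod>p\<in>P. 1 - 1 / real p)\<bar> \<le> C"
    using count_upto_free_of_primes[OF assms(1,2)] by blast
  then have "(\<lambda>N. real (count_upto {n. \<forall>p\<in>P. \<not> p dvd n} N) / real N) \<longlonglongrightarrow> (\<Prod>p\<in>P. 1 - 1 / real p)"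
    by (rule tendsto_if_bounded_error)
  from order_tendstoD(2)[OF this assms(3)] eventually_gt_at_top[of 0]
  show ?thesis unfolding eventually_density_le_def
  proof eventually_elim
    case (elim N)
    then show ?case by (simp add: divide_simps mult.commute)
  qed
qed

section \<open>The abundancy does not concentrate near 2\<close>

lemma sum_inverse_squares_tail:
  assumes "K \<ge> 1"
  shows "(\<Sum>d\<in>{K<..X}. 1 / (real d)\<^sup>2) \<le> 1 / real K"
proof -
  have "(\<Sum>d\<in>{K<..X}. 1 / (real d)\<^sup>2) \<le> 1 / real K - 1 / real X" if "X \<ge> K"
    using that
  proof (induction X rule: dec_induct)
    case (step X)
    have "X > 0" using step.hyps assms by simp
    then have "1 / (real (Suc X))\<^sup>2 \<le> 1 / real X - 1 / real (Suc X)"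
      by (simp add: divide_simps power2_eq_square)
    moreover have "{K<..Suc X} = insert (Suc X) {K<..X}" using step.hyps by auto
    ultimately show ?case using step.IH by simp
  qed simp
  moreover have "1 / real K - 1 / real X \<le> 1 / real K" by simp
  ultimately show ?thesis
    by (cases "X \<ge> K") (linarith, simp)
qed

lemma count_upto_square_multiples:
  assumes "K \<ge> 1" "finite P" "\<And>p. p \<in> P \<Longrightarrow> K < p"
  shows "real (count_upto {n. \<exists>p\<in>P. p\<^sup>2 dvd n} N) \<le> real N / real K"
proof -
  have card_multiples: "card {n \<in> {1..N}. m dvd n} \<le> N div m" if "m \<ge> 1" for m
  proof -
    have "{n \<in> {1..N}. m dvd n} \<subseteq> (\<lambda>k. m * k) ` {1..N div m}"
      using that by (auto elim!: dvdE simp: less_eq_div_iff_mult_less_eq mult.commute Suc_le_eq intro: Nat.gr0I)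
    from card_mono[OF _ this] card_image_le[of "{1..N div m}" "\<lambda>k. m * k"] show ?thesis by simp
  qed
  have "count_upto {n. \<exists>p\<in>P. p\<^sup>2 dvd n} N = card (\<Union>p\<in>P. {n \<in> {1..N}. p\<^sup>2 dvd n})"
    unfolding count_upto_def by (rule arg_cong[of _ _ card]) auto
  also have "\<dots> \<le> (\<Sum>p\<in>P. card {n \<in> {1..N}. p\<^sup>2 dvd n})"
    using assms(2) by (rule card_UN_le)
  also have "\<dots> \<le> (\<Sum>p\<in>P. N div p\<^sup>2)"
    using assms(1,3) by (intro sum_mono card_multiples) (force simp: Suc_le_eq)
  finally have "real (count_upto {n. \<exists>p\<in>P. p\<^sup>2 dvd n} N) \<le> (\<Sum>p\<in>P. real (N div p\<^sup>2))"
    by (metis of_nat_le_iff of_nat_sum)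
  also have "\<dots> \<le> (\<Sum>p\<in>P. real N * (1 / (real p)\<^sup>2))"
    by (intro sum_mono) (simp add: order.trans[OF of_nat_div_le_of_nat])
  also have "\<dots> \<le> (\<Sum>p\<in>{K<..Max (insert 0 P)}. real N * (1 / (real p)\<^sup>2))"
    using assms by (intro sum_mono2) auto
  also have "\<dots> = real N * (\<Sum>p\<in>{K<..Max (insert 0 P)}. 1 / (real p)\<^sup>2)"
    by (simp add: sum_distrib_left)
  also have "\<dots> \<le> real N * (1 / real K)"
    by (intro mult_left_mono sum_inverse_squares_tail assms) simp
  finally show ?thesis by simp
qed

text \<open>Take a finite set $P$ of primes above $K$ with small $\prod_{p\in P}(1-1/p)$. Apart from
  a set of small density, every $n$ has a prime $p\in P$ that divides it exactly once. If also
  $2\le\sigma(n)/n<2+\varepsilon$, then the abundancy of $m=n/p$ lies in the interval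
  $[2,2+\varepsilon)/(1+1/p)$. For small $\varepsilon$ these intervals are disjoint for different $p$,
  so $m$ determines $p$ and hence $n$. As $m\le N/K$, there are at most $N/K$ such $n\le N$.\<close>

lemma abundancy_not_concentrated:
  assumes "c > 0"
  obtains \<epsilon> :: real where "\<epsilon> > 0"
    "eventually_density_le {n. n \<ge> 1 \<and> 2 \<le> abundancy n \<and> abundancy n < 2 + \<epsilon>} c"
proof -
  obtain K :: nat where "1 / (c / 4) < real K" using reals_Archimedean2 by blast
  with assms have "K > 0" by (cases K) (auto simp: field_simps)
  with \<open>1 / (c / 4) < real K\<close> assms have K: "K \<ge> 1" "1 / real K \<le> c / 4"
    by (auto simp: field_simps)
  obtain P where P: "finite P" "\<And>p. p \<in> P \<Longrightarrow> prime p" "\<And>p. p \<in> P \<Longrightarrow> K < p"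
      "(\<Prod>p\<in>P. 1 - 1 / real p) < c / 4"
    using prime_products_small[of "c / 4" K] assms by auto
  define X where "X = Max (insert 1 P)"
  have X: "X \<ge> 1" "\<And>p. p \<in> P \<Longrightarrow> p \<le> X" unfolding X_def using P(1) by auto
  \<comment> \<open>Two primes in \<open>P\<close> have reciprocals that differ by at least this much.\<close>
  define \<epsilon> where "\<epsilon> = 1 / (real X)\<^sup>2"
  define B where "B = {n. n \<ge> 1 \<and> 2 \<le> abundancy n \<and> abundancy n < 2 + \<epsilon>}"
  \<comment> \<open>The intervals \<open>[2, 2 + \<epsilon>) / (1 + 1 / p)\<close> are disjoint for different \<open>p \<in> P\<close>.\<close>
  have quotient_order: "q \<le> p" if pq: "p \<in> P" "q \<in> P" "m \<ge> 1"
      "(1 + 1 / real p) * abundancy m < 2 + \<epsilon>" "2 \<le> (1 + 1 / real q) * abundancy m" for p q m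
  proof (rule ccontr)
    assume "\<not> q \<le> p"
    have pos: "0 < p" "0 < q" using P(3)[OF pq(1)] P(3)[OF pq(2)] by auto
    have "\<epsilon> \<le> 1 / (real p * real q)"
      unfolding \<epsilon>_def power2_eq_square using X pq(1,2) pos
      by (intro divide_left_mono mult_mono) auto
    also have "\<dots> \<le> (real q - real p) / (real p * real q)"
      using \<open>\<not> q \<le> p\<close> pos by (intro divide_right_mono) auto
    also have "\<dots> = (1 / real p - 1 / real q) * 1"
      using pos by (simp add: field_simps)
    also have "\<dots> \<le> (1 / real p - 1 / real q) * abundancy m"
      using pos \<open>\<not> q \<le> p\<close> by (intro mult_left_mono abundancy_ge_1 pq(3)) (simp add: field_simps)
    finally show False using pq(4,5) by (simp add: algebra_simps)
  qed
  define C where "C = {n \<in> B. \<exists>p\<in>P. p dvd n \<and> \<not> p\<^sup>2 dvd n}"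
  define pr where "pr n = (SOME p. p \<in> P \<and> p dvd n \<and> \<not> p\<^sup>2 dvd n)" for n
  have pr: "pr n \<in> P" "n = pr n * (n div pr n)" "n div pr n \<ge> 1"
    "abundancy n = (1 + 1 / real (pr n)) * abundancy (n div pr n)" if "n \<in> C" for n
  proof -
    have "\<exists>p. p \<in> P \<and> p dvd n \<and> \<not> p\<^sup>2 dvd n" using that unfolding C_def by blast
    then have *: "pr n \<in> P \<and> pr n dvd n \<and> \<not> (pr n)\<^sup>2 dvd n"
      unfolding pr_def by (rule someI_ex)
    then show "pr n \<in> P" and eq: "n = pr n * (n div pr n)" by auto
    have "n \<ge> 1" using that unfolding C_def B_def by simp
    then show ge1: "n div pr n \<ge> 1" using eq by (cases "n div pr n") auto
    have "\<not> pr n dvd n div pr n"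
      using * eq by (metis mult_dvd_mono dvd_refl power2_eq_square)
    from abundancy_prime_times[OF P(2) this ge1] * eq
    show "abundancy n = (1 + 1 / real (pr n)) * abundancy (n div pr n)" by metis
  qed
  have "count_upto C N \<le> N div K" for N
  proof -
    have "inj_on (\<lambda>n. n div pr n) C"
    proof (rule inj_onI)
      fix n n' assume n: "n \<in> C" "n' \<in> C" and eq: "n div pr n = n' div pr n'"
      have "2 \<le> abundancy n" "abundancy n < 2 + \<epsilon>" "2 \<le> abundancy n'" "abundancy n' < 2 + \<epsilon>"
        using n unfolding C_def B_def by auto
      then have "pr n = pr n'"
        using quotient_order[of "pr n" "pr n'" "n div pr n"] quotient_order[of "pr n'" "pr n" "n div pr n"]
          pr[OF n(1)] pr[OF n(2)] eq by auto
      then show "n = n'" using pr(2)[OF n(1)] pr(2)[OF n(2)] eq by metis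
    qed
    then have inj: "inj_on (\<lambda>n. n div pr n) (C \<inter> {1..N})"
      by (rule inj_on_subset) auto
    have "(\<lambda>n. n div pr n) ` (C \<inter> {1..N}) \<subseteq> {1..N div K}"
    proof (rule image_subsetI)
      fix n assume n: "n \<in> C \<inter> {1..N}"
      have "n div pr n \<le> N div pr n" using n by (intro div_le_mono) auto
      also have "\<dots> \<le> N div K"
        using n K(1) P(3)[of "pr n"] pr(1)[of n] by (intro div_le_mono2) auto
      finally have "n div pr n \<le> N div K" .
      then show "n div pr n \<in> {1..N div K}" using pr(3)[of n] n by auto
    qed
    from card_inj_on_le[OF inj this] show ?thesis unfolding count_upto_def by simp
  qed
  then have count_C: "real (count_upto C N) \<le> real N / real K" for N
    by (rule order.trans[OF iffD2[OF of_nat_le_iff] of_nat_div_le_of_nat])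
  have K_bound: "real N / real K \<le> c / 4 * real N" for N
    using mult_right_mono[OF K(2), of "real N"] by simp
  have C: "eventually_density_le C (c / 4)"
    unfolding eventually_density_le_def
    by (intro always_eventually allI order.trans[OF count_C K_bound])
  have "eventually_density_le {n. \<exists>p\<in>P. p\<^sup>2 dvd n} (c / 4)"
    unfolding eventually_density_le_def
    by (intro always_eventually allI
          order.trans[OF count_upto_square_multiples[OF K(1) P(1,3)] K_bound])
  from eventually_density_le_Un[OF eventually_density_le_Un[OF
        eventually_density_le_free_of_primes[OF P(1,2,4)] this] C]
  have "eventually_density_le B c"
    by (rule eventually_density_le_subset) (use assms in \<open>auto simp: C_def\<close>)
  moreover have "\<epsilon> > 0" unfolding \<epsilon>_def using X(1) by simp
  ultimately show ?thesis using that unfolding B_def by blast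
qed

section \<open>Large divisors contribute little on average\<close>

lemma sum_large_part:
  assumes "finite A" "\<And>k. k \<in> A \<Longrightarrow> f k \<in> {1..X}"
  shows "(\<Sum>k\<in>A. large_part y (f k)) = (\<Sum>d\<in>{y<..X}. real (card {k \<in> A. d dvd f k}) * (1 / real d))"
proof -
  have "(\<Sum>k\<in>A. large_part y (f k)) = (\<Sum>k\<in>A. \<Sum>d | d \<in> {y<..X} \<and> d dvd f k. 1 / real d)"
    unfolding large_part_def
  proof (rule sum.cong[OF refl], rule sum.cong)
    fix k assume "k \<in> A"
    with assms(2) have "f k \<in> {1..X}" .
    then show "{d. y < d \<and> d dvd f k} = {d. d \<in> {y<..X} \<and> d dvd f k}"
      by (auto dest: dvd_imp_le)
  qed simp
  also have "\<dots> = (\<Sum>d\<in>{y<..X}. \<Sum>k | k \<in> A \<and> d dvd f k. 1 / real d)"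
    using assms(1) by (intro sum.swap_restrict) auto
  finally show ?thesis by simp
qed

lemma card_le_if_congruent:
  fixes A :: "nat set"
  assumes "A \<subseteq> {1..T}" "\<And>a b. a \<in> A \<Longrightarrow> b \<in> A \<Longrightarrow> a mod q = b mod q"
  shows "card A \<le> T div q + 1"
proof -
  have "inj_on (\<lambda>k. k div q) A"
    by (rule inj_onI) (metis assms(2) div_mult_mod_eq)
  moreover have "(\<lambda>k. k div q) ` A \<subseteq> {0..T div q}"
    using assms(1) by (auto intro!: div_le_mono)
  ultimately show ?thesis using card_inj_on_le[of _ A "{0..T div q}"] by simp
qed

text \<open>Two solutions $k$ differ by a multiple of $d/\gcd(d,M)$, and any solvable congruence
  has $\gcd(d,M)$ at most $g$.\<close>

lemma card_dvd_progression_le: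
  fixes M i g d :: nat
  assumes "M \<ge> 1" "d \<ge> 1" and gcd_le: "\<And>k. d dvd k * M + i \<Longrightarrow> gcd d M \<le> g"
  shows "real (card {k \<in> {1..T}. d dvd k * M + i}) \<le> real T * real g / real d + 1"
proof (cases "\<exists>k. d dvd k * M + i")
  case True
  define r where "r = gcd d M"
  define q where "q = d div r"
  have r: "r \<le> g" "r \<ge> 1" using True gcd_le assms unfolding r_def by (auto simp: Suc_le_eq)
  have d: "d = q * r" unfolding q_def r_def by simp
  then have "q \<ge> 1" using assms(2) by (cases q) auto
  have congruent: "a mod q = b mod q"
    if "a \<in> {k \<in> {1..T}. d dvd k * M + i}" "b \<in> {k \<in> {1..T}. d dvd k * M + i}" for a b
  proof -
    have "int d dvd (int a * int M + int i) - (int b * int M + int i)"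
      using that by (intro dvd_diff) (simp_all flip: of_nat_mult of_nat_add)
    then have "int d dvd (int a - int b) * int M" by (simp add: algebra_simps)
    then have "int q * int r dvd (int a - int b) * int (M div r) * int r"
      unfolding d by (metis r_def dvd_div_mult_self gcd_dvd2 mult.assoc of_nat_mult)
    then have "int q dvd (int a - int b) * int (M div r)"
      using r(2) by (simp add: dvd_times_right_cancel_iff)
    moreover have "coprime (int q) (int (M div r))"
      unfolding q_def r_def coprime_int_iff using assms(1) by (intro div_gcd_coprime) auto
    ultimately have "int q dvd int a - int b" by (simp add: coprime_dvd_mult_left_iff)
    then show ?thesis by (metis mod_eq_dvd_iff of_nat_eq_iff of_nat_mod)
  qed
  have "card {k \<in> {1..T}. d dvd k * M + i} \<le> T div q + 1"
    by (rule card_le_if_congruent[OF _ congruent]) auto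
  then have "real (card {k \<in> {1..T}. d dvd k * M + i}) \<le> real (T div q) + 1" by linarith
  also have "real (T div q) \<le> real T / real q" by (rule of_nat_div_le_of_nat)
  also have "\<dots> = real T * real r / real d"
    using \<open>q \<ge> 1\<close> r(2) unfolding d by (simp add: field_simps)
  also have "\<dots> \<le> real T * real g / real d"
    using r(1) by (intro divide_right_mono mult_left_mono) auto
  finally show ?thesis by simp
qed simp

text \<open>Only sublinear growth matters: the harmonic sum collects the errors of at most $1$
  that occur when multiples of $d$ are counted, weighted by $1/d$.\<close>

lemma harm_le_two_sqrt: "harm n \<le> 2 * sqrt (real n)"
proof (induction n)
  case (Suc n)
  define a b where "a = sqrt (real n)" and "b = sqrt (real (Suc n))"
  have ab: "0 \<le> a" "a \<le> b" "1 \<le> b" and sq: "b\<^sup>2 = a\<^sup>2 + 1" "b\<^sup>2 = real (Suc n)"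
    unfolding a_def b_def by auto
  have "(b - a) * (b + a) = 1"
    using sq(1) by (simp add: algebra_simps power2_eq_square)
  moreover have "(b - a) * (b + a) \<le> (b - a) * (2 * b)"
    using ab by (intro mult_left_mono) auto
  ultimately have "1 / b \<le> 2 * (b - a)"
    using ab by (simp add: field_simps)
  moreover have "1 / b\<^sup>2 \<le> 1 / b"
    using ab by (intro divide_left_mono) (auto simp: power2_eq_square)
  ultimately have "inverse (real (Suc n)) \<le> 2 * (b - a)"
    unfolding sq(2)[symmetric] by (simp add: inverse_eq_divide)
  with Suc show ?case unfolding harm_Suc a_def b_def by simp
qed (simp add: harm_def)

text \<open>A first moment bound (Markov's inequality). It is used with $M=1$, $i=0$ for all
  integers, and with a highly divisible $M$ for the progression $kM+i$, where
  $\gcd(d,M)$ divides $i$.\<close>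

lemma large_part_rare_in_progression:
  fixes M i g y :: nat and c e :: real
  assumes "M \<ge> 1" "y \<ge> 1" "c > 0" "e > 0"
    and gcd_le: "\<And>k d. d dvd k * M + i \<Longrightarrow> gcd d M \<le> g"
  shows "eventually_density_le {k. large_part y (k * M + i) \<ge> c} (real g / (real y * c) + e)"
proof -
  \<comment> \<open>From here on \<open>2 * sqrt (T * (M + i)) \<le> c * e * T\<close>, which absorbs the harmonic error term.\<close>
  have "\<forall>\<^sub>F T in sequentially. 4 * real (M + i) / (c * e)\<^sup>2 \<le> real T"
    by (rule eventually_sequentiallyI[of "nat \<lceil>4 * real (M + i) / (c * e)\<^sup>2\<rceil>"]) linarith
  then show ?thesis
    unfolding eventually_density_le_def using eventually_gt_at_top[of 0]
  proof eventually_elim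
    case (elim T)
    define B where "B = {k. large_part y (k * M + i) \<ge> c}"
    have "c * real (count_upto B T) = (\<Sum>k\<in>B \<inter> {1..T}. c)"
      unfolding count_upto_def by simp
    also have "\<dots> \<le> (\<Sum>k\<in>B \<inter> {1..T}. large_part y (k * M + i))"
      unfolding B_def by (intro sum_mono) auto
    also have "\<dots> \<le> (\<Sum>k\<in>{1..T}. large_part y (k * M + i))"
      by (intro sum_mono2) (auto simp: large_part_nonneg)
    also have "\<dots> = (\<Sum>d\<in>{y<..T * M + i}. real (card {k \<in> {1..T}. d dvd k * M + i}) * (1 / real d))"
      using assms(1) by (intro sum_large_part) (auto simp: Suc_le_eq)
    also have "\<dots> \<le> (\<Sum>d\<in>{y<..T * M + i}. (real T * real g / real d + 1) * (1 / real d))"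
      using assms(1) gcd_le
      by (intro sum_mono mult_right_mono card_dvd_progression_le) auto
    also have "\<dots> = (\<Sum>d\<in>{y<..T * M + i}. real T * real g * (1 / (real d)\<^sup>2) + 1 / real d)"
      by (rule sum.cong) (auto simp: field_simps power2_eq_square)
    also have "\<dots> = real T * real g * (\<Sum>d\<in>{y<..T * M + i}. 1 / (real d)\<^sup>2)
                    + (\<Sum>d\<in>{y<..T * M + i}. 1 / real d)"
      by (simp add: sum.distrib sum_distrib_left)
    also have "\<dots> \<le> real T * real g * (1 / real y) + c * e * real T"
    proof (intro add_mono mult_left_mono sum_inverse_squares_tail assms(2))
      have "(\<Sum>d\<in>{y<..T * M + i}. 1 / real d) \<le> harm (T * M + i)"
        unfolding harm_def inverse_eq_divide by (intro sum_mono2) auto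
      also have "\<dots> \<le> 2 * sqrt (real (T * M + i))" by (rule harm_le_two_sqrt)
      also have "\<dots> = sqrt (4 * real (T * M + i))" unfolding real_sqrt_mult by simp
      also have "\<dots> \<le> c * e * real T"
      proof (rule real_le_lsqrt)
        have "i \<le> T * i" using elim(2) by simp
        then have "real (T * M + i) \<le> real (T * (M + i))"
          unfolding of_nat_le_iff by (simp add: distrib_left)
        then have "4 * real (T * M + i) \<le> 4 * real (M + i) * real T"
          unfolding of_nat_mult by (simp only: mult.assoc mult.commute[of "real T"] mult_le_cancel_left_pos zero_less_numeral)
        also have "\<dots> \<le> ((c * e)\<^sup>2 * real T) * real T"
          using elim(1) assms(3,4) by (intro mult_right_mono) (simp_all add: field_simps)
        finally show "4 * real (T * M + i) \<le> (c * e * real T)\<^sup>2"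
          by (simp add: power2_eq_square algebra_simps)
      qed (use assms in auto)
      finally show "(\<Sum>d\<in>{y<..T * M + i}. 1 / real d) \<le> c * e * real T" .
    qed auto
    also have "\<dots> = c * ((real g / (real y * c) + e) * real T)"
      using assms(2,3) by (simp add: field_simps)
    finally show "real (count_upto B T) \<le> (real g / (real y * c) + e) * real T"
      using assms(3) by simp
  qed
qed

lemma eventually_density_le_shift:
  assumes "eventually_density_le A c" "c \<ge> 0"
  shows "eventually_density_le {n. n + i \<in> A} (2 * c)"
proof -
  have "\<forall>\<^sub>F N in sequentially. real (count_upto A (N + i)) \<le> c * real (N + i)"
    using assms(1) unfolding eventually_density_le_def by (rule eventually_compose_filterlim[OF _ filterlim_add_const_nat_at_top])
  then show ?thesis
    unfolding eventually_density_le_def using eventually_ge_at_top[of i]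
  proof eventually_elim
    case (elim N)
    have "count_upto {n. n + i \<in> A} N \<le> count_upto A (N + i)"
      unfolding count_upto_def
      by (rule card_inj_on_le[of "\<lambda>n. n + i"]) auto
    moreover have "c * real (N + i) \<le> c * (2 * real N)"
      using elim(2) assms(2) by (intro mult_left_mono) auto
    ultimately show ?case using elim(1) by linarith
  qed
qed

lemma eventually_density_le_UN:
  assumes "finite I" "\<And>i. i \<in> I \<Longrightarrow> eventually_density_le (A i) c"
  shows "eventually_density_le (\<Union>i\<in>I. A i) (real (card I) * c)"
  using assms
proof (induction I rule: finite_induct)
  case empty
  show ?case by (simp add: eventually_density_le_def count_upto_def)
next
  case (insert i I)
  then have "eventually_density_le (A i \<union> (\<Union>i\<in>I. A i)) (c + real (card I) * c)"
    by (intro eventually_density_le_Un) auto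
  with insert.hyps show ?case by (simp add: algebra_simps)
qed

section \<open>Windows of deficient numbers\<close>

definition deficient_window :: "nat set" where
  "deficient_window = {n. n \<ge> 1 \<and> (\<forall>i\<in>{1..5}. deficient (n + i))}"

lemma obtain_common_multiple:
  obtains Q :: nat where "Q \<ge> 1" "\<And>d. d \<in> {1..y} \<Longrightarrow> d dvd Q"
proof
  show "fact y \<ge> (1::nat)" by (rule fact_ge_1)
  show "d dvd fact y" if "d \<in> {1..y}" for d :: nat
    using that by (intro dvd_fact) auto
qed

text \<open>Replacing the abundancy by its small part gives a periodic set $F$ that contains all
  windows. If $n$ lies in $F$ but is not a window, then for some $i$ the number $m=n+i$ has small part
  below $2$ and abundancy at least $2$. So either its large part is at least $\varepsilon$, or its
  abundancy lies in $[2,2+\varepsilon)$. Both are rare, the first one for large $y$.\<close>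

lemma convergent_density_deficient_window:
  "convergent (\<lambda>N. real (count_upto deficient_window N) / real N)"
proof (rule convergent_density_if_approximable)
  fix e :: real assume "e > 0"
  \<comment> \<open>Two bounds \<open>e / 30\<close> come from the moment estimate and one from here; shifting doubles
    the total \<open>e / 10\<close>, and there are five shifts.\<close>
  obtain \<epsilon> :: real where \<epsilon>: "\<epsilon> > 0"
      "eventually_density_le {n. n \<ge> 1 \<and> 2 \<le> abundancy n \<and> abundancy n < 2 + \<epsilon>} (e / 30)"
    using abundancy_not_concentrated[of "e / 30"] \<open>e > 0\<close> by auto
  obtain y :: nat where "30 / (\<epsilon> * e) < real y" using reals_Archimedean2 by blast
  moreover have "0 < 30 / (\<epsilon> * e)" using \<epsilon>(1) \<open>e > 0\<close> by simp
  moreover from calculation have "y > 0" by (cases y) auto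
  ultimately have y: "y \<ge> 1" "1 / (real y * \<epsilon>) \<le> e / 30"
    using \<epsilon>(1) \<open>e > 0\<close> by (auto simp: field_simps)
  obtain Q where Q: "Q \<ge> 1" "\<And>d. d \<in> {1..y} \<Longrightarrow> d dvd Q"
    using obtain_common_multiple by blast
  define F where "F = {n. \<forall>i\<in>{1..5}. small_part y (n + i) < 2}"
  define D where "D = {n. n \<ge> 1 \<and> small_part y n < 2 \<and> 2 \<le> abundancy n}"
  have "eventually_density_le {n. large_part y n \<ge> \<epsilon>} (1 / (real y * \<epsilon>) + e / 30)"
    using large_part_rare_in_progression[of 1 y \<epsilon> "e / 30" 0 1] y(1) \<epsilon>(1) \<open>e > 0\<close> by simp
  from eventually_density_le_Un[OF \<epsilon>(2) this]
  have "eventually_density_le D (e / 10)"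
    by (rule eventually_density_le_subset) (use y(2) in \<open>auto simp: D_def abundancy_split[of _ y]\<close>)
  then have "eventually_density_le {n. n + i \<in> D} (2 * (e / 10))" for i
    using \<open>e > 0\<close> by (intro eventually_density_le_shift) auto
  then have "eventually_density_le (\<Union>i\<in>{1..5::nat}. {n. n + i \<in> D}) (real (card {1..5::nat}) * (2 * (e / 10)))"
    by (intro eventually_density_le_UN) auto
  then have "eventually_density_le (F - deficient_window) e"
  proof (rule eventually_density_le_subset)
    fix n :: nat assume "n \<ge> 1" "n \<in> F - deficient_window"
    then obtain i where i: "i \<in> {1..5}" "\<not> deficient (n + i)"
      unfolding deficient_window_def by auto
    then have "n + i \<in> D"
      using \<open>n \<in> F - deficient_window\<close> deficient_iff_abundancy[of "n + i"]
      unfolding D_def F_def by auto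
    with i(1) show "n \<in> (\<Union>i\<in>{1..5}. {n. n + i \<in> D})" by blast
  qed simp
  moreover have "deficient_window \<subseteq> F"
  proof
    fix n assume "n \<in> deficient_window"
    then have "abundancy (n + i) < 2" if "i \<in> {1..5}" for i
      using that deficient_iff_abundancy[of "n + i"] unfolding deficient_window_def by auto
    moreover have "small_part y (n + i) \<le> abundancy (n + i)" if "i \<in> {1..5}" for i
      using that abundancy_split[of "n + i" y] large_part_nonneg[of y "n + i"] by auto
    ultimately show "n \<in> F" unfolding F_def by fastforce
  qed
  moreover have "convergent (\<lambda>N. real (count_upto F N) / real N)"
  proof (rule convergent_density_periodic[OF Q(1)])
    show "n + Q \<in> F \<longleftrightarrow> n \<in> F" for n
    proof -
      have "small_part y (n + Q + i) = small_part y (n + i)" for i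
        using small_part_periodic[OF Q(2), where n = "n + i"] by (simp add: ac_simps)
      then show ?thesis unfolding F_def by simp
    qed
  qed
  ultimately show "\<exists>F. deficient_window \<subseteq> F \<and>
      convergent (\<lambda>N. real (count_upto F N) / real N) \<and> eventually_density_le (F - deficient_window) e"
    by blast
qed

text \<open>The maximum is attained at $4$. The gap to $2$ leaves $1/4$ for the large part.\<close>

lemma abundancy_le_five:
  assumes "i \<in> {1..5}"
  shows "abundancy i \<le> 7 / 4"
proof -
  have "{1,2,3,4,5} = {1..5::nat}" by auto
  then have "{d. d dvd i} = {d \<in> {1,2,3,4,5}. d dvd i}"
    using assms by (auto dest: dvd_imp_le intro: Nat.gr0I simp: Suc_le_eq)
  then have "abundancy i = (\<Sum>d\<in>{1,2,3,4,5}. if d dvd i then 1 / real d else 0)"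
    unfolding abundancy_def by (simp only: sum.inter_filter finite_insert finite.emptyI)
  moreover have "i \<in> {1,2,3,4,5}" using assms by auto
  ultimately show ?thesis by auto
qed

text \<open>If all $d\le y$ divide $M$, then the divisors $d\le y$ of $kM+i$ divide $i$, so the small
  part of $kM+i$ is at most $\sigma(i)/i\le 7/4$. By the first moment bound, for at least half of all
  $k$ the large parts of $kM+1,\dots,kM+5$ are all below $1/4$.\<close>

lemma deficient_window_frequent:
  obtains M :: nat where "M \<ge> 1"
    "\<forall>\<^sub>F T in sequentially. real T / 2 \<le> real (count_upto deficient_window (T * M))"
proof -
  \<comment> \<open>Each of the five exceptional sets has density at most \<open>5 / (y / 4) + 1 / 20 = 1 / 10\<close>. As \<open>y\<close> is
    opaque and only a common multiple of \<open>1, \<dots>, y\<close> is used, no huge number is ever computed.\<close>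
  obtain y :: nat where y: "y = 400" by simp
  obtain M :: nat where M: "M \<ge> 1" "\<And>d. d \<in> {1..y} \<Longrightarrow> d dvd M"
    using obtain_common_multiple by blast
  define R where "R = (\<Union>i\<in>{1..5}. {k. large_part y (k * M + i) \<ge> 1 / 4})"
  have "eventually_density_le {k. large_part y (k * M + i) \<ge> 1 / 4} (1 / 10)" if i: "i \<in> {1..5}" for i
  proof -
    have "gcd d M \<le> 5" if "d dvd k * M + i" for d k
    proof -
      have "gcd d M dvd k * M + i" using that by (rule dvd_trans[OF gcd_dvd1])
      then have "gcd d M dvd i" by (simp add: dvd_add_right_iff)
      then show ?thesis using i by (auto dest!: dvd_imp_le)
    qed
    then have "eventually_density_le {k. large_part y (k * M + i) \<ge> 1 / 4} (real 5 / (real y * (1 / 4)) + 1 / 20)"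
      using M(1) y by (intro large_part_rare_in_progression) auto
    then show ?thesis using y by simp
  qed
  then have "eventually_density_le R (real (card {1..5::nat}) * (1 / 10))"
    unfolding R_def by (intro eventually_density_le_UN) auto
  then have "eventually_density_le R (1 / 2)" by simp
  then have "\<forall>\<^sub>F T in sequentially. real T / 2 \<le> real (count_upto deficient_window (T * M))"
    unfolding eventually_density_le_def
  proof eventually_elim
    case (elim T)
    have good: "k * M \<in> deficient_window" if k: "k \<in> {1..T} - R" for k
      unfolding deficient_window_def
    proof (intro CollectI conjI ballI)
      show "1 \<le> k * M" using k M(1) by auto
      fix i :: nat assume i: "i \<in> {1..5}"
      have "{d. d \<in> {1..y} \<and> d dvd k * M + i} \<subseteq> {d. d dvd i}"
        using M(2) by (auto simp: dvd_add_right_iff)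
      then have "small_part y (k * M + i) \<le> abundancy i"
        unfolding small_part_def abundancy_def using i by (intro sum_mono2) auto
      also have "\<dots> \<le> 7 / 4" using i by (rule abundancy_le_five)
      finally have "abundancy (k * M + i) < 2"
        using abundancy_split[of "k * M + i" y] i k unfolding R_def by force
      then show "deficient (k * M + i)"
        using deficient_iff_abundancy[of "k * M + i"] i by auto
    qed
    have "T - count_upto R T \<le> card ({1..T} - R)"
      unfolding count_upto_def using diff_card_le_card_Diff[of "R \<inter> {1..T}" "{1..T}"]
      by (simp add: Diff_Int_distrib Diff_Int)
    also have "\<dots> \<le> count_upto deficient_window (T * M)"
      unfolding count_upto_def using good M(1)
      by (intro card_inj_on_le[of "\<lambda>k. k * M"]) (auto simp: inj_on_def Suc_le_eq)
    finally show ?case using elim by linarith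
  qed
  with M(1) that show ?thesis by blast
qed

theorem corollary1p14:
  shows "\<exists>\<delta>>0. has_density {n::nat. n \<ge> 1 \<and> (\<forall>i\<in>{1..5}. deficient (n + i))} \<delta>"
proof -
  obtain \<delta> where lim: "(\<lambda>N. real (count_upto deficient_window N) / real N) \<longlonglongrightarrow> \<delta>"
    using convergent_density_deficient_window unfolding convergent_def by blast
  obtain M :: nat where M: "M \<ge> 1"
    "\<forall>\<^sub>F T in sequentially. real T / 2 \<le> real (count_upto deficient_window (T * M))"
    using deficient_window_frequent by blast
  have "strict_mono (\<lambda>T. T * M)" using M(1) by (auto simp: strict_mono_def)
  from LIMSEQ_subseq_LIMSEQ[OF lim this]
  have "(\<lambda>T. real (count_upto deficient_window (T * M)) / real (T * M)) \<longlonglongrightarrow> \<delta>"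
    by (simp add: o_def)
  moreover have "\<forall>\<^sub>F T in sequentially.
      1 / (2 * real M) \<le> real (count_upto deficient_window (T * M)) / real (T * M)"
    using M(2) eventually_gt_at_top[of 0]
  proof eventually_elim
    case (elim T)
    then show ?case using M(1) by (simp add: field_simps)
  qed
  ultimately have "1 / (2 * real M) \<le> \<delta>"
    by (rule tendsto_lowerbound) simp
  moreover have "0 < 1 / (2 * real M)" using M(1) by simp
  ultimately have "\<delta> > 0" by linarith
  with lim show ?thesis
    unfolding has_density_def count_upto_def deficient_window_def by blast
qed

end
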